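(* Let $p$ be a prime number, let $\lambda:\mathbb Z/p\curvearrowright\mathcal G$ be an action by automorphisms on an ample groupoid $\mathcal G$ whose unit space is a Cantor set, free on $\mathcal G^{(0)}$, and put $\mathcal H:=\mathcal G\rtimes_\lambda\mathbb Z/p$. Assume that $\mathcal G$ and $\mathcal H$ are effective, minimal, and each either almost finite or purely infinite. Then the groups $\mathsf F(\mathcal G)\rtimes_\lambda\mathbb Z/p$ and $\mathrm N(\mathsf D(\mathcal H),\mathsf D(\mathcal G))$ act topologically primitively on $\mathcal G^{(0)}$. In fact, $\mathsf D(\mathcal G)$ itself acts topologically primitively on $\mathcal G^{(0)}$.
   Context: Topological primitivity. An action of a group by homeomorphisms on a Cantor set $X$ is topologically primitive if it is minimal (every orbit is dense) and preserves no partition of $X$ into closed sets other than $\{X\}$ and the partition into singletons; preserving a partition means permuting its classes. Groupoids. An étale groupoid is a second countable locally compact Hausdorff topological groupoid whose range map is a local homeomorphism; $\mathcal G^{(0)}$ is the unit space, $s(g)=g^{-1}g$, $r(g)=gg^{-1}$. It is ample if $\mathcal G^{(0)}$ is totally disconnected. A bisection is a subset on which $r$ and $s$ are injective. $\mathcal G$ is minimal if every orbit $r(s^{-1}(x))$ is dense in $\mathcal G^{(0)}$; effective if the interior of $\{g\mid r(g)=s(g)\}$ is $\mathcal G^{(0)}$; principal if $\{g\mid r(g)=s(g)\}=\mathcal G^{(0)}$. Full groups. For an effective ample groupoid with compact unit space, a full bisection is a compact open bisection $U$ with $r(U)=s(U)=\mathcal G^{(0)}$; $\theta_U:=r\circ(s|_U)^{-1}\in\mathrm{Homeo}(\mathcal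 G^{(0)})$. $\mathsf F(\mathcal G)$ is the group of all such $\theta_U$, $\mathsf D(\mathcal G)$ its commutator subgroup. $\mathrm N(\Gamma,S)=\{\alpha\in\Gamma\mid\alpha S\alpha^{-1}=S\}$. Almost finite / purely infinite. An elementary subgroupoid is a compact open principal subgroupoid $\mathcal K\subset\mathcal G$ with $\mathcal K^{(0)}=\mathcal G^{(0)}$; $\mathcal Kx=\{g\in\mathcal K\mid s(g)=x\}$. $\mathcal G$ is almost finite if for every compact $C\subset\mathcal G$ and $\varepsilon>0$ there is an elementary subgroupoid $\mathcal K$ with $\#(C\mathcal Kx\setminus\mathcal Kx)/\#(\mathcal Kx)<\varepsilon$ for all $x\in\mathcal G^{(0)}$. It is purely infinite if for every clopen $A\subset\mathcal G^{(0)}$ there are compact open bisections $U,V$ with $s(U)=s(V)=A$, $r(U)\cap r(V)=\emptyset$, $r(U)\cup r(V)\subset A$. Semidirect product. $\mathcal G\rtimes_\lambda\mathbb Z/p$ is $\mathcal G\times\mathbb Z/p$ with the product topology, unit space identified with $\mathcal G^{(0)}$, $r(g,a)=r(g)$, $s(g,a)=\lambda_a^{-1}(s(g))$, $(g,a)(h,b)=(g\lambda_a(h),a+b)$. $\mathcal G$ is identified with $\mathcal G\times\{0\}\subset\mathcal H$, so $\mathsf F(\mathcal G)\subset\mathsf F(\mathcal H)$ and $\mathsf D(\mathcal G)\subset\mathsf D(\mathcal H)$. The restriction of $\lambda_a$ to $\mathcal G^{(0)}$ is an element of $\mathsf F(\mathcal H)$, and $\mathsf F(\mathcal G)\rtimes_\lambda\mathbb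 Z/p$ denotes the subgroup of $\mathsf F(\mathcal H)$ generated by $\mathsf F(\mathcal G)$ and all $\lambda_a$ (an internal semidirect product). *)

theory Defs
  imports
    "HOL-Analysis.Abstract_Topological_Spaces"
    "HOL-Analysis.Function_Topology"
    "HOL-Algebra.Elementary_Groups"
    "HOL-Algebra.Group_Action"
    "HOL-Computational_Algebra.Primes"
    "HOL-Library.Disjoint_Sets"
begin

section \<open>Topological spaces and topological primitivity\<close>

definition cantor_space :: "'a topology \<Rightarrow> bool" where
  "cantor_space X \<longleftrightarrow>
     X homeomorphic_space product_topology (\<lambda>_::nat. discrete_topology (UNIV::bool set)) UNIV"

definition totally_disconnected_space :: "'a topology \<Rightarrow> bool" where
  "totally_disconnected_space X \<longleftrightarrow> (\<forall>S. connectedin X S \<longrightarrow> (\<exists>x. S \<subseteq> {x}))"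

definition local_homeomorphism :: "'a topology \<Rightarrow> 'b topology \<Rightarrow> ('a \<Rightarrow> 'b) \<Rightarrow> bool" where
  "local_homeomorphism X Y f \<longleftrightarrow>
     (\<forall>x\<in>topspace X. \<exists>U. x \<in> U \<and> openin X U \<and> openin Y (f ` U) \<and>
        homeomorphic_map (subtopology X U) (subtopology Y (f ` U)) f)"

definition topologically_primitive ::
  "'a topology \<Rightarrow> ('b, 'c) monoid_scheme \<Rightarrow> ('b \<Rightarrow> 'a \<Rightarrow> 'a) \<Rightarrow> bool" where
  "topologically_primitive X A \<phi> \<longleftrightarrow>
     group_action A (topspace X) \<phi> \<and>
     (\<forall>a\<in>carrier A. homeomorphic_map X X (\<phi> a)) \<and>
     (\<forall>x\<in>topspace X. X closure_of (orbit A \<phi> x) = topspace X) \<and>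
     (\<forall>P. partition_on (topspace X) P \<and> (\<forall>C\<in>P. closedin X C) \<and>
          (\<forall>a\<in>carrier A. (\<lambda>C. \<phi> a ` C) ` P = P)
        \<longrightarrow> P = {topspace X} \<or> P = (\<lambda>x. {x}) ` topspace X)"

text \<open>A subgroup \<open>\<Gamma>\<close> of \<^const>\<open>BijGroup\<close> of the space, acting tautologically.\<close>

definition acts_topologically_primitively :: "'a topology \<Rightarrow> ('a \<Rightarrow> 'a) set \<Rightarrow> bool" where
  "acts_topologically_primitively X \<Gamma> \<longleftrightarrow>
     topologically_primitive X ((BijGroup (topspace X))\<lparr>carrier := \<Gamma>\<rparr>) (\<lambda>\<gamma>. \<gamma>)"

section \<open>Topological groupoids\<close>

text \<open>The set of arrows is the underlying set of the topology; the multiplication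
  is relevant only on pairs \<open>(g, h)\<close> with \<open>src G g = rng G h\<close>.\<close>

record 'a top_groupoid =
  gtop :: "'a topology"
  gmul :: "'a \<Rightarrow> 'a \<Rightarrow> 'a"
  ginv :: "'a \<Rightarrow> 'a"

abbreviation arr :: "('a, 'm) top_groupoid_scheme \<Rightarrow> 'a set" where
  "arr G \<equiv> topspace (gtop G)"

definition src :: "('a, 'm) top_groupoid_scheme \<Rightarrow> 'a \<Rightarrow> 'a" where
  "src G g = gmul G (ginv G g) g"

definition rng :: "('a, 'm) top_groupoid_scheme \<Rightarrow> 'a \<Rightarrow> 'a" where
  "rng G g = gmul G g (ginv G g)"

definition units :: "('a, 'm) top_groupoid_scheme \<Rightarrow> 'a set" where
  "units G = src G ` arr G"

definition unit_space :: "('a, 'm) top_groupoid_scheme \<Rightarrow> 'a topology" where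
  "unit_space G = subtopology (gtop G) (units G)"

definition composable_pairs :: "('a, 'm) top_groupoid_scheme \<Rightarrow> ('a \<times> 'a) set" where
  "composable_pairs G = {(g, h). g \<in> arr G \<and> h \<in> arr G \<and> src G g = rng G h}"

locale groupoid =
  fixes G :: "('a, 'm) top_groupoid_scheme" (structure)
  assumes inv_closed: "g \<in> arr G \<Longrightarrow> ginv G g \<in> arr G"
    and inv_inv: "g \<in> arr G \<Longrightarrow> ginv G (ginv G g) = g"
    and src_closed: "g \<in> arr G \<Longrightarrow> src G g \<in> arr G"
    and src_src: "g \<in> arr G \<Longrightarrow> src G (src G g) = src G g"
    and rng_src: "g \<in> arr G \<Longrightarrow> rng G (src G g) = src G g"
    and mul_src: "g \<in> arr G \<Longrightarrow> gmul G g (src G g) = g"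
    and rng_mul: "g \<in> arr G \<Longrightarrow> gmul G (rng G g) g = g"
    and mul_closed: "(g, h) \<in> composable_pairs G \<Longrightarrow> gmul G g h \<in> arr G"
    and src_mul: "(g, h) \<in> composable_pairs G \<Longrightarrow> src G (gmul G g h) = src G h"
    and rng_of_mul: "(g, h) \<in> composable_pairs G \<Longrightarrow> rng G (gmul G g h) = rng G g"
    and mul_assoc: "(g, h) \<in> composable_pairs G \<Longrightarrow> (h, k) \<in> composable_pairs G \<Longrightarrow>
          gmul G (gmul G g h) k = gmul G g (gmul G h k)"

locale topological_groupoid = groupoid +
  assumes continuous_inv: "continuous_map (gtop G) (gtop G) (ginv G)"
    and continuous_mul:
      "continuous_map (subtopology (prod_topology (gtop G) (gtop G)) (composable_pairs G))
         (gtop G) (\<lambda>(g, h). gmul G g h)"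

locale etale_groupoid = topological_groupoid +
  assumes second_countable: "second_countable (gtop G)"
    and locally_compact: "locally_compact_space (gtop G)"
    and Hausdorff: "Hausdorff_space (gtop G)"
    and etale: "local_homeomorphism (gtop G) (unit_space G) (rng G)"

locale ample_groupoid = etale_groupoid +
  assumes totally_disconnected: "totally_disconnected_space (unit_space G)"

definition minimal_groupoid :: "('a, 'm) top_groupoid_scheme \<Rightarrow> bool" where
  "minimal_groupoid G \<longleftrightarrow>
     (\<forall>x\<in>units G. unit_space G closure_of (rng G ` {g \<in> arr G. src G g = x}) = units G)"

definition effective_groupoid :: "('a, 'm) top_groupoid_scheme \<Rightarrow> bool" where
  "effective_groupoid G \<longleftrightarrow> gtop G interior_of {g \<in> arr G. rng G g = src G g} = units G"

definition bisection :: "('a, 'm) top_groupoid_scheme \<Rightarrow> 'a set \<Rightarrow> bool" where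
  "bisection G U \<longleftrightarrow> U \<subseteq> arr G \<and> inj_on (rng G) U \<and> inj_on (src G) U"

definition compact_open_bisection :: "('a, 'm) top_groupoid_scheme \<Rightarrow> 'a set \<Rightarrow> bool" where
  "compact_open_bisection G U \<longleftrightarrow> bisection G U \<and> compactin (gtop G) U \<and> openin (gtop G) U"

section \<open>Full groups\<close>

definition full_bisection :: "('a, 'm) top_groupoid_scheme \<Rightarrow> 'a set \<Rightarrow> bool" where
  "full_bisection G U \<longleftrightarrow>
     compact_open_bisection G U \<and> rng G ` U = units G \<and> src G ` U = units G"

definition bisection_homeo :: "('a, 'm) top_groupoid_scheme \<Rightarrow> 'a set \<Rightarrow> 'a \<Rightarrow> 'a" where
  "bisection_homeo G U = (\<lambda>x\<in>units G. rng G (the_inv_into U (src G) x))"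

definition full_group :: "('a, 'm) top_groupoid_scheme \<Rightarrow> ('a \<Rightarrow> 'a) set" where
  "full_group G = bisection_homeo G ` {U. full_bisection G U}"

definition commutator_full_group :: "('a, 'm) top_groupoid_scheme \<Rightarrow> ('a \<Rightarrow> 'a) set" where
  "commutator_full_group G = derived (BijGroup (units G)) (full_group G)"

definition normalizer_in :: "('b, 'c) monoid_scheme \<Rightarrow> 'b set \<Rightarrow> 'b set \<Rightarrow> 'b set" where
  "normalizer_in B \<Gamma> S = {\<alpha> \<in> \<Gamma>. (\<alpha> <#\<^bsub>B\<^esub> S) #>\<^bsub>B\<^esub> (inv\<^bsub>B\<^esub> \<alpha>) = S}"

section \<open>Almost finite and purely infinite groupoids\<close>

definition subgroupoid :: "('a, 'm) top_groupoid_scheme \<Rightarrow> 'a set \<Rightarrow> bool" where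
  "subgroupoid G K \<longleftrightarrow> K \<subseteq> arr G \<and> (\<forall>g\<in>K. ginv G g \<in> K) \<and>
     (\<forall>g\<in>K. \<forall>h\<in>K. src G g = rng G h \<longrightarrow> gmul G g h \<in> K)"

definition elementary_subgroupoid :: "('a, 'm) top_groupoid_scheme \<Rightarrow> 'a set \<Rightarrow> bool" where
  "elementary_subgroupoid G K \<longleftrightarrow>
     subgroupoid G K \<and> compactin (gtop G) K \<and> openin (gtop G) K \<and>
     {g \<in> K. rng G g = src G g} = src G ` K \<and> src G ` K = units G"

definition arrows_from :: "('a, 'm) top_groupoid_scheme \<Rightarrow> 'a set \<Rightarrow> 'a \<Rightarrow> 'a set" where
  "arrows_from G K x = {g \<in> K. src G g = x}"

definition set_product :: "('a, 'm) top_groupoid_scheme \<Rightarrow> 'a set \<Rightarrow> 'a set \<Rightarrow> 'a set" where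
  "set_product G C D = {gmul G c d | c d. c \<in> C \<and> d \<in> D \<and> src G c = rng G d}"

text \<open>The sets whose cardinality is taken below are finite in an etale groupoid:
  fibres of \<open>src\<close> are discrete and \<open>C\<close>, \<open>K\<close> are compact.\<close>

definition almost_finite :: "('a, 'm) top_groupoid_scheme \<Rightarrow> bool" where
  "almost_finite G \<longleftrightarrow>
     (\<forall>C. compactin (gtop G) C \<longrightarrow> (\<forall>\<epsilon>::real. \<epsilon> > 0 \<longrightarrow>
       (\<exists>K. elementary_subgroupoid G K \<and>
         (\<forall>x\<in>units G.
            real (card (set_product G C (arrows_from G K x) - arrows_from G K x))
              / real (card (arrows_from G K x)) < \<epsilon>))))"

definition purely_infinite :: "('a, 'm) top_groupoid_scheme \<Rightarrow> bool" where
  "purely_infinite G \<longleftrightarrow>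
     (\<forall>A. openin (unit_space G) A \<and> closedin (unit_space G) A \<longrightarrow>
       (\<exists>U V. compact_open_bisection G U \<and> compact_open_bisection G V \<and>
          src G ` U = A \<and> src G ` V = A \<and>
          rng G ` U \<inter> rng G ` V = {} \<and> rng G ` U \<union> rng G ` V \<subseteq> A))"

section \<open>Actions by automorphisms and semidirect products\<close>

definition groupoid_automorphism :: "('a, 'm) top_groupoid_scheme \<Rightarrow> ('a \<Rightarrow> 'a) \<Rightarrow> bool" where
  "groupoid_automorphism G f \<longleftrightarrow>
     homeomorphic_map (gtop G) (gtop G) f \<and>
     (\<forall>(g, h)\<in>composable_pairs G.
        (f g, f h) \<in> composable_pairs G \<and> f (gmul G g h) = gmul G (f g) (f h))"

definition acts_by_automorphisms ::
  "('b, 'c) monoid_scheme \<Rightarrow> ('a, 'm) top_groupoid_scheme \<Rightarrow> ('b \<Rightarrow> 'a \<Rightarrow> 'a) \<Rightarrow> bool" where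
  "acts_by_automorphisms A G lam \<longleftrightarrow>
     group_action A (arr G) lam \<and> (\<forall>a\<in>carrier A. groupoid_automorphism G (lam a))"

definition free_on_units ::
  "('b, 'c) monoid_scheme \<Rightarrow> ('a, 'm) top_groupoid_scheme \<Rightarrow> ('b \<Rightarrow> 'a \<Rightarrow> 'a) \<Rightarrow> bool" where
  "free_on_units A G lam \<longleftrightarrow>
     (\<forall>a\<in>carrier A. \<forall>x\<in>units G. lam a x = x \<longrightarrow> a = \<one>\<^bsub>A\<^esub>)"

definition semidirect ::
  "('a, 'm) top_groupoid_scheme \<Rightarrow> ('b, 'c) monoid_scheme \<Rightarrow> ('b \<Rightarrow> 'a \<Rightarrow> 'a)
     \<Rightarrow> ('a \<times> 'b) top_groupoid" where
  "semidirect G A lam =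
     \<lparr>gtop = prod_topology (gtop G) (discrete_topology (carrier A)),
      gmul = (\<lambda>(g, a) (h, b). (gmul G g (lam a h), a \<otimes>\<^bsub>A\<^esub> b)),
      ginv = (\<lambda>(g, a). (lam (inv\<^bsub>A\<^esub> a) (ginv G g), inv\<^bsub>A\<^esub> a))\<rparr>"

lemma rng_src_semidirect:
  assumes G: "groupoid G" and act: "acts_by_automorphisms A G lam"
    and g: "g \<in> arr G" and a: "a \<in> carrier A"
  shows "rng (semidirect G A lam) (g, a) = (rng G g, \<one>\<^bsub>A\<^esub>)"
    and "src (semidirect G A lam) (g, a) = (lam (inv\<^bsub>A\<^esub> a) (src G g), \<one>\<^bsub>A\<^esub>)"
proof -
  interpret groupoid G by (rule G)
  interpret group_action A "arr G" lam using act by (simp add: acts_by_automorphisms_def)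
  interpret A: group A using group_hom group_hom.axioms(1) by blast
  have ig: "ginv G g \<in> arr G" using g by (rule inv_closed)
  have "lam a (lam (inv\<^bsub>A\<^esub> a) (ginv G g)) = lam \<one>\<^bsub>A\<^esub> (ginv G g)"
    using composition_rule[OF ig a A.inv_closed[OF a]] a by simp
  also have "\<dots> = ginv G g" using id_eq_one ig by (metis restrict_apply)
  finally show "rng (semidirect G A lam) (g, a) = (rng G g, \<one>\<^bsub>A\<^esub>)"
    using a by (simp add: rng_def semidirect_def)
  have "(ginv G g, g) \<in> composable_pairs G"
    using g ig inv_inv by (simp add: composable_pairs_def src_def rng_def)
  then have "lam (inv\<^bsub>A\<^esub> a) (gmul G (ginv G g) g)
      = gmul G (lam (inv\<^bsub>A\<^esub> a) (ginv G g)) (lam (inv\<^bsub>A\<^esub> a) g)"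
    using act A.inv_closed[OF a]
    unfolding acts_by_automorphisms_def groupoid_automorphism_def by blast
  then show "src (semidirect G A lam) (g, a) = (lam (inv\<^bsub>A\<^esub> a) (src G g), \<one>\<^bsub>A\<^esub>)"
    using a by (simp add: src_def semidirect_def)
qed

text \<open>The units of \<^term>\<open>semidirect G A lam\<close> are the pairs \<open>(x, \<one>)\<close> with \<open>x\<close> a unit of
  \<open>G\<close>. The following is the commutator subgroup of the full group of the semidirect product,
  transported along the identification of \<open>(x, \<one>)\<close> with \<open>x\<close>, so that it consists of
  permutations of \<^term>\<open>units G\<close>. A bisection \<open>U\<close> of \<open>G\<close> induces the same permutation
  as the bisection \<open>U \<times> {\<one>}\<close> of the semidirect product, so no transport is needed for \<open>G\<close>.\<close>

definition semidirect_commutator_full_group ::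
  "('a, 'm) top_groupoid_scheme \<Rightarrow> ('b, 'c) monoid_scheme \<Rightarrow> ('b \<Rightarrow> 'a \<Rightarrow> 'a) \<Rightarrow> ('a \<Rightarrow> 'a) set" where
  "semidirect_commutator_full_group G A lam =
     (\<lambda>\<theta>. \<lambda>x\<in>units G. fst (\<theta> (x, \<one>\<^bsub>A\<^esub>))) ` commutator_full_group (semidirect G A lam)"

definition full_group_extension ::
  "('a, 'm) top_groupoid_scheme \<Rightarrow> ('b, 'c) monoid_scheme \<Rightarrow> ('b \<Rightarrow> 'a \<Rightarrow> 'a) \<Rightarrow> ('a \<Rightarrow> 'a) set" where
  "full_group_extension G A lam =
     generate (BijGroup (units G)) (full_group G \<union> (\<lambda>a. restrict (lam a) (units G)) ` carrier A)"

end

theory Submission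
  imports Defs "HOL-Algebra.Zassenhaus"
begin

text \<open>
  Minimality of \<open>G\<close> is enough. A group of homeomorphisms acts topologically primitively as soon as
  for all points \<open>x \<noteq> y\<close> and every nonempty open \<open>W\<close> some element fixes \<open>y\<close> and moves \<open>x\<close> into \<open>W\<close>:
  if a closed class \<open>C\<close> contains \<open>x \<noteq> y\<close> but is not everything, such an element for the complement
  \<open>W\<close> of \<open>C\<close> preserves \<open>C\<close>, which contains \<open>y\<close>, and yet moves \<open>x\<close> out of \<open>C\<close>.
  The commutator subgroup has this property: the orbit of \<open>x\<close> meets \<open>W\<close> in two further points \<open>u\<close>
  and \<open>v\<close>, and the commutator of the transpositions \<open>(x u)\<close> and \<open>(x v)\<close>, realised by
  small compact open bisections, maps \<open>x\<close> to \<open>u\<close> and fixes \<open>y\<close>. The property passes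
  to the two larger groups, which consist of homeomorphisms.
\<close>

section \<open>Groups of homeomorphisms\<close>

lemma mult_BijGroup_apply:
  assumes "f \<in> carrier (BijGroup S)" "g \<in> carrier (BijGroup S)" "x \<in> S"
  shows "(f \<otimes>\<^bsub>BijGroup S\<^esub> g) x = f (g x)"
  using assms by (simp add: BijGroup_def compose_def)

lemma inv_BijGroup_apply:
  assumes "f \<in> carrier (BijGroup S)" "x \<in> S"
  shows "(inv\<^bsub>BijGroup S\<^esub> f) (f x) = x"
proof -
  interpret group "BijGroup S" by (rule group_BijGroup)
  have "(inv\<^bsub>BijGroup S\<^esub> f \<otimes>\<^bsub>BijGroup S\<^esub> f) x = (inv\<^bsub>BijGroup S\<^esub> f) (f x)"
    using assms by (intro mult_BijGroup_apply) auto
  moreover have "(inv\<^bsub>BijGroup S\<^esub> f \<otimes>\<^bsub>BijGroup S\<^esub> f) = \<one>\<^bsub>BijGroup S\<^esub>"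
    using assms by (intro l_inv)
  ultimately show ?thesis using assms by (simp add: BijGroup_def)
qed

text \<open>Functions outside the space are pinned down by the carrier condition, so equality here
  is equality in \<open>BijGroup\<close>, and derived subgroups, generated subgroups and normalizers
  can all be taken in that one ambient group.\<close>

definition homeo_group :: "'a topology \<Rightarrow> ('a \<Rightarrow> 'a) set" where
  "homeo_group X = {f \<in> carrier (BijGroup (topspace X)). homeomorphic_map X X f}"

text \<open>Elements of \<open>BijGroup\<close> are extensional, so a homeomorphism has to be
  restricted before it can count as a group element.\<close>

lemma restrict_in_homeo_group:
  assumes "homeomorphic_map X X f"
  shows "restrict f (topspace X) \<in> homeo_group X"
proof -
  have "homeomorphic_map X X (restrict f (topspace X))"
    using assms by (rule homeomorphic_map_eq) simp
  moreover have "bij_betw f (topspace X) (topspace X)"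
    using assms by (simp add: bij_betw_def homeomorphic_eq_everything_map)
  then have "bij_betw (restrict f (topspace X)) (topspace X) (topspace X)"
    by (simp cong: bij_betw_cong)
  ultimately show ?thesis by (simp add: homeo_group_def BijGroup_def Bij_def)
qed

text \<open>Serves as an upper bound: whatever is generated by homeomorphisms, commutators included,
  stays inside this subgroup.\<close>

lemma subgroup_homeo_group: "subgroup (homeo_group X) (BijGroup (topspace X))"
proof -
  interpret group "BijGroup (topspace X)" by (rule group_BijGroup)
  show ?thesis
  proof (rule subgroupI)
    show "homeo_group X \<subseteq> carrier (BijGroup (topspace X))" by (auto simp: homeo_group_def)
    have "\<one>\<^bsub>BijGroup (topspace X)\<^esub> \<in> homeo_group X"
      using restrict_in_homeo_group[OF homeomorphic_map_id[THEN iffD2, OF refl], of X]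
      by (simp add: BijGroup_def id_def)
    then show "homeo_group X \<noteq> {}" by blast
  next
    fix f assume f: "f \<in> homeo_group X"
    then obtain g where g: "homeomorphic_maps X X f g"
      by (auto simp: homeo_group_def homeomorphic_map_maps)
    let ?i = "inv\<^bsub>BijGroup (topspace X)\<^esub> f"
    have fB: "f \<in> carrier (BijGroup (topspace X))" using f by (simp add: homeo_group_def)
    have "g y = ?i y" if "y \<in> topspace X" for y
    proof -
      have "g y \<in> topspace X" "f (g y) = y"
        using g that by (auto simp: homeomorphic_maps_def continuous_map_def)
      then show ?thesis using inv_BijGroup_apply[OF fB, of "g y"] by simp
    qed
    then have "homeomorphic_map X X ?i"
      using g homeomorphic_map_eq[of X X g] by (simp add: homeomorphic_maps_map)
    then show "?i \<in> homeo_group X" using fB by (simp add: homeo_group_def)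
  next
    fix f g assume fg: "f \<in> homeo_group X" "g \<in> homeo_group X"
    then have "homeomorphic_map X X (f \<circ> g)"
      by (auto simp: homeo_group_def intro: homeomorphic_map_compose)
    then have "homeomorphic_map X X (f \<otimes>\<^bsub>BijGroup (topspace X)\<^esub> g)"
      using fg by (elim homeomorphic_map_eq) (simp add: mult_BijGroup_apply homeo_group_def)
    then show "f \<otimes>\<^bsub>BijGroup (topspace X)\<^esub> g \<in> homeo_group X"
      using fg by (simp add: homeo_group_def)
  qed
qed

section \<open>A criterion for topological primitivity\<close>

lemma acts_topologically_primitively_if_moves_fixing:
  assumes sub: "subgroup \<Gamma> (BijGroup (topspace X))" and homeo: "\<Gamma> \<subseteq> homeo_group X"
    and nontriv: "\<And>x. topspace X \<noteq> {x}"
    and move: "\<And>x y W. \<lbrakk>x \<in> topspace X; y \<in> topspace X; x \<noteq> y; openin X W; W \<noteq> {}\<rbrakk>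
      \<Longrightarrow> \<exists>\<gamma>\<in>\<Gamma>. \<gamma> y = y \<and> \<gamma> x \<in> W"
  shows "acts_topologically_primitively X \<Gamma>"
proof -
  let ?B = "BijGroup (topspace X)" and ?A = "BijGroup (topspace X)\<lparr>carrier := \<Gamma>\<rparr>"
  interpret B: group ?B by (rule group_BijGroup)
  have "group ?A" using sub by (rule B.subgroup_imp_group)
  moreover have "(\<lambda>\<gamma>. \<gamma>) \<in> hom ?A ?B" using sub by (auto simp: hom_def dest: subgroup.mem_carrier)
  ultimately have act: "group_action ?A (topspace X) (\<lambda>\<gamma>. \<gamma>)"
    by (simp add: group_action_def group_hom_def group_hom_axioms_def B.group_axioms)
  \<comment> \<open>Minimality needs no separate argument: with any second point as the one to be
    fixed, \<open>move\<close> sends \<open>x\<close> into \<open>W\<close>. This is where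
    \<open>nontriv\<close> enters.\<close>
  have dense: "X closure_of (orbit ?A (\<lambda>\<gamma>. \<gamma>) x) = topspace X" if x: "x \<in> topspace X" for x
    unfolding dense_intersects_open
  proof (intro allI impI, elim conjE)
    fix W assume W: "openin X W" "W \<noteq> {}"
    obtain y where "y \<in> topspace X" "x \<noteq> y" using x nontriv[of x] by blast
    then obtain \<gamma> where "\<gamma> \<in> \<Gamma>" "\<gamma> x \<in> W" using move x W by blast
    then show "orbit ?A (\<lambda>\<gamma>. \<gamma>) x \<inter> W \<noteq> {}" by (auto simp: orbit_def)
  qed
  have prim: "P = {topspace X} \<or> P = (\<lambda>x. {x}) ` topspace X"
    if P: "partition_on (topspace X) P" and closed: "\<forall>C\<in>P. closedin X C"
      and inva: "\<forall>\<gamma>\<in>\<Gamma>. (\<lambda>C. \<gamma> ` C) ` P = P" for P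
  proof (cases "\<exists>C\<in>P. \<exists>x\<in>C. \<exists>y\<in>C. x \<noteq> y")
    case True
    then obtain C x y where C: "C \<in> P" "x \<in> C" "y \<in> C" "x \<noteq> y" by blast
    have CX: "C \<subseteq> topspace X" using P C by (auto simp: partition_on_def)
    have "C = topspace X"
    proof (rule ccontr)
      assume "C \<noteq> topspace X"
      then have "topspace X - C \<noteq> {}" "openin X (topspace X - C)" using CX closed C by auto
      then obtain \<gamma> where \<gamma>: "\<gamma> \<in> \<Gamma>" "\<gamma> y = y" "\<gamma> x \<in> topspace X - C"
        using move[of x y "topspace X - C"] C CX by blast
      have "\<gamma> ` C \<in> P" using inva \<gamma> C by blast
      moreover have "y \<in> \<gamma> ` C" using \<gamma>(2) C(3) by force
      \<comment> \<open>Both sets are classes of \<open>P\<close> and share the fixed point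
        \<open>y\<close>.\<close>
      ultimately have "\<gamma> ` C = C" using P C unfolding partition_on_def disjoint_def by blast
      then show False using \<gamma> C by blast
    qed
    have "D = C" if "D \<in> P" for D
    proof -
      have "D \<noteq> {}" "D \<subseteq> C"
        using P that unfolding \<open>C = topspace X\<close> by (auto simp: partition_on_def)
      then show ?thesis using P C that unfolding partition_on_def disjoint_def by blast
    qed
    then show ?thesis using C \<open>C = topspace X\<close> by blast
  next
    case False
    have "C \<in> (\<lambda>x. {x}) ` topspace X" if "C \<in> P" for C
    proof -
      have "C \<noteq> {}" "C \<subseteq> topspace X" using P that by (auto simp: partition_on_def)
      then obtain x where "x \<in> C" "x \<in> topspace X" by blast
      moreover have "C = {x}" using False that \<open>x \<in> C\<close> by blast
      ultimately show ?thesis by blast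
    qed
    moreover have "{x} \<in> P" if "x \<in> topspace X" for x
    proof -
      obtain C where "C \<in> P" "x \<in> C"
        using P \<open>x \<in> topspace X\<close> unfolding partition_on_def by blast
      moreover have "C = {x}" using False \<open>x \<in> C\<close> \<open>C \<in> P\<close> by blast
      ultimately show ?thesis by simp
    qed
    ultimately show ?thesis by blast
  qed
  show ?thesis
    unfolding acts_topologically_primitively_def topologically_primitive_def
    using act dense prim homeo by (auto simp: homeo_group_def)
qed

section \<open>Cantor spaces\<close>

lemma cantor_space_compact:
  assumes "cantor_space X" shows "compact_space X"
proof -
  let ?D = "product_topology (\<lambda>_::nat. discrete_topology (UNIV::bool set)) UNIV"
  have "compact_space ?D"
    unfolding compact_space_product_topology by (simp add: compact_space_discrete_topology)
  then show ?thesis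
    using assms homeomorphic_compact_space unfolding cantor_space_def by blast
qed

text \<open>A basic cylinder constrains finitely many coordinates, each to a subset of a discrete
  space, so it is clopen. The clause \<open>K \<noteq> {f}\<close> records that there are no
  isolated points: flipping a free coordinate of \<open>f\<close> gives a second point of the
  cylinder.\<close>

lemma cantor_cube_clopen_base:
  fixes f :: "nat \<Rightarrow> bool"
  defines "D \<equiv> product_topology (\<lambda>_. discrete_topology UNIV) UNIV"
  assumes "openin D U" "f \<in> U"
  shows "\<exists>K. openin D K \<and> closedin D K \<and> f \<in> K \<and> K \<subseteq> U \<and> K \<noteq> {f}"
proof -
  obtain W :: "nat \<Rightarrow> bool set" where W: "finite {i. W i \<noteq> UNIV}" "f \<in> Pi\<^sub>E UNIV W" "Pi\<^sub>E UNIV W \<subseteq> U"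
    using assms(2,3) unfolding D_def openin_product_topology_alt by fastforce
  have "openin D (Pi\<^sub>E UNIV W)" using W(1) unfolding D_def
    by (auto simp: openin_PiE_gen)
  moreover have "closedin D (Pi\<^sub>E UNIV W)" unfolding D_def
    by (auto simp: closedin_product_topology)
  moreover obtain n where "W n = UNIV" using W(1) ex_new_if_finite[OF infinite_UNIV_nat] by blast
  then have "f(n := \<not> f n) \<in> Pi\<^sub>E UNIV W" using W(2) by (auto simp: PiE_iff)
  moreover have "f(n := \<not> f n) \<noteq> f" by (metis fun_upd_same)
  ultimately show ?thesis using W by (intro exI[of _ "Pi\<^sub>E UNIV W"]) auto
qed

lemma cantor_space_clopen_base:
  assumes "cantor_space X" "openin X U" "x \<in> U"
  shows "\<exists>K. openin X K \<and> closedin X K \<and> x \<in> K \<and> K \<subseteq> U \<and> K \<noteq> {x}"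
proof -
  let ?D = "product_topology (\<lambda>_::nat. discrete_topology (UNIV::bool set)) UNIV"
  obtain f g where fg: "homeomorphic_maps X ?D f g"
    using assms(1) unfolding cantor_space_def homeomorphic_space_def by blast
  then have f: "homeomorphic_map X ?D f" and g: "homeomorphic_map ?D X g"
    and gf: "\<And>x. x \<in> topspace X \<Longrightarrow> g (f x) = x" by (auto simp: homeomorphic_maps_map)
  have UX: "U \<subseteq> topspace X" using assms(2) by (rule openin_subset)
  have "openin ?D (f ` U)" using assms(2) f homeomorphic_map_openness UX by blast
  then obtain K where K: "openin ?D K" "closedin ?D K" "f x \<in> K" "K \<subseteq> f ` U" "K \<noteq> {f x}"
    using cantor_cube_clopen_base[of "f ` U" "f x"] assms(3) by auto
  have KD: "K \<subseteq> topspace ?D" using K(1) by (rule openin_subset)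
  have "openin X (g ` K)" "closedin X (g ` K)"
    using K KD g homeomorphic_map_openness homeomorphic_map_closedness by blast+
  moreover have "x \<in> g ` K" using K(3) gf[of x] UX assms(3) by force
  moreover have "g ` K \<subseteq> U" using K(4) gf UX by force
  moreover have "g ` K \<noteq> {x}"
  proof
    assume eq: "g ` K = {x}"
    have "k = f x" if "k \<in> K" for k
    proof -
      obtain u where u: "u \<in> U" "k = f u" using K(4) \<open>k \<in> K\<close> by blast
      then have "g k = u" using gf UX by blast
      moreover have "g k = x" using eq \<open>k \<in> K\<close> by blast
      ultimately show ?thesis using u by simp
    qed
    then show False using K(3,5) by blast
  qed
  ultimately show ?thesis by blast
qed

text \<open>Points are deleted one at a time. The T1 property keeps the set open, and it cannot
  become empty because no open set is a singleton.\<close>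

lemma cantor_space_open_minus_finite:
  assumes "cantor_space X" "t1_space X" "finite F" "openin X W" "W \<noteq> {}"
  shows "openin X (W - F) \<and> W - F \<noteq> {}"
  using assms(3)
proof (induction F)
  case empty
  then show ?case using assms by simp
next
  case (insert a F)
  have "W - F \<noteq> {a}"
  proof
    assume eq: "W - F = {a}"
    then obtain K where "K \<subseteq> W - F" "a \<in> K" "K \<noteq> {a}"
      using cantor_space_clopen_base[OF assms(1), of "W - F" a] insert.IH by blast
    then show False using eq by blast
  qed
  moreover have "openin X (W - F - {a})"
    using assms(2) insert.IH by (simp add: t1_space_openin_delete_alt)
  moreover have "W - insert a F = W - F - {a}" by blast
  ultimately show ?case using insert.IH by auto
qed


section \<open>Groupoids and their full groups\<close>

context groupoid
begin

lemma inv_src_rng: "g \<in> arr G \<Longrightarrow> src G (ginv G g) = rng G g" "g \<in> arr G \<Longrightarrow> rng G (ginv G g) = src G g"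
  by (simp_all add: src_def rng_def inv_inv)

lemma units_subset_arr: "units G \<subseteq> arr G"
  using src_closed by (auto simp: units_def)

lemma src_in_units: "g \<in> arr G \<Longrightarrow> src G g \<in> units G"
  by (simp add: units_def)

lemma rng_in_units: "g \<in> arr G \<Longrightarrow> rng G g \<in> units G"
  using src_in_units[of "ginv G g"] by (simp add: inv_src_rng inv_closed)

lemma src_unit: "x \<in> units G \<Longrightarrow> src G x = x" and rng_unit: "x \<in> units G \<Longrightarrow> rng G x = x"
  by (auto simp: units_def src_src rng_src)

lemma topspace_unit_space: "topspace (unit_space G) = units G"
  using units_subset_arr by (auto simp: unit_space_def)

text \<open>Multiplying \<open>g g = g\<close> by the inverse of \<open>g\<close> turns
  \<open>g\<close> into its own source. An automorphism is only required to respect composable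
  products, and this characterisation of units is what makes it preserve them.\<close>

lemma idempotent_in_units:
  assumes "(g, g) \<in> composable_pairs G" "gmul G g g = g"
  shows "g \<in> units G"
proof -
  have g: "g \<in> arr G" "src G g = rng G g" using assms(1) by (auto simp: composable_pairs_def)
  have "(ginv G g, g) \<in> composable_pairs G"
    using g by (simp add: composable_pairs_def inv_closed inv_src_rng)
  then have "gmul G (gmul G (ginv G g) g) g = gmul G (ginv G g) (gmul G g g)"
    using assms(1) mul_assoc by blast
  then have "gmul G (src G g) g = src G g" using assms(2) by (simp add: src_def)
  then have "src G g = g" using g rng_mul by simp
  then show ?thesis using g src_in_units by metis
qed

end

section \<open>Continuity of source and range\<close>

context topological_groupoid
begin

lemma continuous_src: "continuous_map (gtop G) (gtop G) (src G)"
proof -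
  \<comment> \<open>The source map is multiplication after the map from \<open>g\<close> to the
    composable pair of its inverse and itself.\<close>
  have "continuous_map (gtop G)
      (subtopology (prod_topology (gtop G) (gtop G)) (composable_pairs G)) (\<lambda>g. (ginv G g, g))"
    by (auto simp: continuous_map_in_subtopology continuous_map_pairedI continuous_inv
        composable_pairs_def inv_closed inv_src_rng)
  from continuous_map_compose[OF this continuous_mul] show ?thesis
    by (simp add: o_def src_def[abs_def])
qed

lemma continuous_rng: "continuous_map (gtop G) (gtop G) (rng G)"
  using continuous_map_compose[OF continuous_inv continuous_src]
  by (rule continuous_map_eq) (simp add: inv_src_rng)

lemma homeomorphic_maps_inv: "homeomorphic_maps (gtop G) (gtop G) (ginv G) (ginv G)"
  by (simp add: homeomorphic_maps_def continuous_inv inv_inv)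

lemma continuous_src_units: "continuous_map (gtop G) (unit_space G) (src G)"
  and continuous_rng_units: "continuous_map (gtop G) (unit_space G) (rng G)"
  using continuous_src continuous_rng
  by (auto simp: unit_space_def continuous_map_in_subtopology src_in_units rng_in_units)

end

text \<open>On a full bisection both source and range are homeomorphisms onto the unit space, and
  the induced map is one after the inverse of the other. The hypotheses are spelled out instead of
  taken from a locale so that the lemma also applies to the semidirect product, for which only these
  facts are established.\<close>

lemma bisection_homeo_in_homeo_group:
  assumes src: "continuous_map (gtop G) (gtop G) (src G)"
    and rng: "continuous_map (gtop G) (gtop G) (rng G)"
    and haus: "Hausdorff_space (gtop G)" and units: "units G \<subseteq> arr G" and U: "full_bisection G U"
  shows "bisection_homeo G U \<in> homeo_group (unit_space G)"
proof -
  let ?Y = "subtopology (gtop G) U"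
  have UB: "U \<subseteq> arr G" "inj_on (rng G) U" "inj_on (src G) U" "compactin (gtop G) U"
      "rng G ` U = units G" "src G ` U = units G"
    using U by (auto simp: full_bisection_def compact_open_bisection_def bisection_def)
  have top: "topspace ?Y = U" "topspace (unit_space G) = units G"
    using UB(1) units by (auto simp: unit_space_def)
  have Y: "compact_space ?Y" using UB(4) by (simp add: compactin_subspace)
  have hu: "Hausdorff_space (unit_space G)"
    unfolding unit_space_def using haus by (rule Hausdorff_space_subtopology)
  \<comment> \<open>A continuous bijection from a compact space onto a Hausdorff space is a
    homeomorphism.\<close>
  have hom: "homeomorphic_map ?Y (unit_space G) f"
    if "continuous_map (gtop G) (gtop G) f" "inj_on f U" "f ` U = units G" for f
  proof (rule continuous_imp_homeomorphic_map[OF _ Y hu])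
    show "continuous_map ?Y (unit_space G) f"
      using that UB(1) unfolding unit_space_def continuous_map_in_subtopology
      by (auto simp: continuous_map_from_subtopology)
  qed (use that top in auto)
  obtain k where k: "homeomorphic_maps ?Y (unit_space G) (src G) k"
    using hom[OF src] UB by (auto simp: homeomorphic_map_maps)
  have "the_inv_into U (src G) x = k x" if "x \<in> units G" for x
    using k UB(3) that top by (intro the_inv_into_f_eq) (auto simp: homeomorphic_maps_def continuous_map_def)
  then have "bisection_homeo G U = restrict (rng G \<circ> k) (topspace (unit_space G))"
    using top(2) by (auto simp: bisection_homeo_def restrict_def)
  moreover have "homeomorphic_map (unit_space G) (unit_space G) (rng G \<circ> k)"
    using k hom[OF rng] UB by (auto simp: homeomorphic_maps_map intro: homeomorphic_map_compose)
  ultimately show ?thesis using restrict_in_homeo_group by metis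
qed

lemma bisection_homeo_src:
  assumes "inj_on (src G) U" "g \<in> U" "src G g \<in> units G"
  shows "bisection_homeo G U (src G g) = rng G g"
  using assms by (simp add: bisection_homeo_def the_inv_into_f_f)

section \<open>Open source and range maps, and small bisections\<close>

context etale_groupoid
begin

lemma Hausdorff_unit_space: "Hausdorff_space (unit_space G)"
  unfolding unit_space_def using Hausdorff by (rule Hausdorff_space_subtopology)

lemma full_group_subset_homeo_group: "full_group G \<subseteq> homeo_group (unit_space G)"
  using bisection_homeo_in_homeo_group[OF continuous_src continuous_rng Hausdorff units_subset_arr]
  by (auto simp: full_group_def)

lemma open_map_rng: "open_map (gtop G) (unit_space G) (rng G)"
  unfolding open_map_def
proof (intro allI impI)
  fix V assume V: "openin (gtop G) V"
  show "openin (unit_space G) (rng G ` V)"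
    unfolding openin_subopen[of _ "rng G ` V"]
  proof
    fix x assume "x \<in> rng G ` V"
    then obtain g where g: "g \<in> V" "x = rng G g" by blast
    moreover have "g \<in> arr G" using V g openin_subset by blast
    ultimately obtain U where U: "g \<in> U" "openin (gtop G) U" "openin (unit_space G) (rng G ` U)"
      and hom: "homeomorphic_map (subtopology (gtop G) U) (subtopology (unit_space G) (rng G ` U)) (rng G)"
      using etale unfolding local_homeomorphism_def by blast
    have "openin (subtopology (gtop G) U) (U \<inter> V)"
      using V by (simp add: openin_subtopology_Int2)
    then have "openin (subtopology (unit_space G) (rng G ` U)) (rng G ` (U \<inter> V))"
      using homeomorphic_imp_open_map[OF hom] unfolding open_map_def by blast
    then have "openin (unit_space G) (rng G ` (U \<inter> V))" using U(3) openin_trans_full by blast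
    then show "\<exists>T. openin (unit_space G) T \<and> x \<in> T \<and> T \<subseteq> rng G ` V"
      using g U(1) by (intro exI[of _ "rng G ` (U \<inter> V)"]) blast
  qed
qed

lemma openin_image_inv: "openin (gtop G) V \<Longrightarrow> openin (gtop G) (ginv G ` V)"
  using homeomorphic_imp_open_map homeomorphic_maps_inv
  unfolding homeomorphic_maps_map open_map_def by blast

lemma rng_image_inv: "V \<subseteq> arr G \<Longrightarrow> rng G ` ginv G ` V = src G ` V"
  and src_image_inv: "V \<subseteq> arr G \<Longrightarrow> src G ` ginv G ` V = rng G ` V"
  by (auto simp: image_image inv_src_rng subset_iff)

lemma open_map_src: "open_map (gtop G) (unit_space G) (src G)"
  unfolding open_map_def
proof (intro allI impI)
  fix V assume V: "openin (gtop G) V"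
  then have "openin (unit_space G) (rng G ` ginv G ` V)"
    using openin_image_inv open_map_rng unfolding open_map_def by blast
  then show "openin (unit_space G) (src G ` V)"
    using V openin_subset by (metis rng_image_inv)
qed

text \<open>The etale condition makes the range map injective near \<open>g\<close> and also near
  its inverse. Inversion exchanges range and source, so the second neighbourhood, inverted, is one
  of \<open>g\<close> on which the source map is injective. The homeomorphism clause is kept for
  pulling compactness back later.\<close>

lemma ex_open_bisection:
  assumes "g \<in> arr G"
  shows "\<exists>U. openin (gtop G) U \<and> g \<in> U \<and> bisection G U \<and>
    homeomorphic_map (subtopology (gtop G) U) (subtopology (unit_space G) (rng G ` U)) (rng G)"
proof -
  have loc: "\<exists>U. h \<in> U \<and> openin (gtop G) U \<and> openin (unit_space G) (rng G ` U) \<and>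
      homeomorphic_map (subtopology (gtop G) U) (subtopology (unit_space G) (rng G ` U)) (rng G)"
    if "h \<in> arr G" for h
    using etale that unfolding local_homeomorphism_def by blast
  obtain U where U: "g \<in> U" "openin (gtop G) U"
    "homeomorphic_map (subtopology (gtop G) U) (subtopology (unit_space G) (rng G ` U)) (rng G)"
    using loc[OF assms] by blast
  obtain V where V: "ginv G g \<in> V" "openin (gtop G) V"
    "homeomorphic_map (subtopology (gtop G) V) (subtopology (unit_space G) (rng G ` V)) (rng G)"
    using loc[OF inv_closed[OF assms]] by blast
  have arr: "U \<subseteq> arr G" "V \<subseteq> arr G" using U(2) V(2) by (auto dest: openin_subset)
  then have inj: "inj_on (rng G) U" "inj_on (rng G) V"
    using U(3) V(3) by (auto simp: homeomorphic_eq_everything_map Int_absorb1)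
  let ?N = "U \<inter> ginv G ` V"
  have "openin (gtop G) ?N" using U(2) openin_image_inv[OF V(2)] by blast
  moreover have "g \<in> ?N" using U(1) V(1) assms by (force simp: inv_inv)
  moreover have "inj_on (src G) (ginv G ` V)"
  proof (rule inj_onI)
    fix a b assume "a \<in> ginv G ` V" "b \<in> ginv G ` V" and eq: "src G a = src G b"
    then obtain v w where "v \<in> V" "w \<in> V" "a = ginv G v" "b = ginv G w" by blast
    with eq arr inj(2) show "a = b" by (auto simp: inv_src_rng inj_on_def subset_iff)
  qed
  then have "bisection G ?N"
    using arr inj(1) by (auto simp: bisection_def intro: inj_on_subset)
  moreover have "homeomorphic_map (subtopology (gtop G) ?N) (subtopology (unit_space G) (rng G ` ?N)) (rng G)"
  proof -
    have "homeomorphic_map (subtopology (subtopology (gtop G) U) ?N)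
        (subtopology (subtopology (unit_space G) (rng G ` U)) (rng G ` ?N)) (rng G)"
      using arr rng_in_units by (intro homeomorphic_map_subtopologies[OF U(3)]) (auto simp: topspace_unit_space)
    moreover have "U \<inter> ?N = ?N" "rng G ` U \<inter> rng G ` ?N = rng G ` ?N" by auto
    ultimately show ?thesis by (simp only: subtopology_subtopology)
  qed
  ultimately show ?thesis by blast
qed

text \<open>An open bisection around \<open>g\<close> is first shrunk until its sources and ranges
  lie in \<open>W\<close> and in disjoint open sets. A clopen set \<open>K\<close> inside its open
  range image is compact, and so is the part of the bisection lying over \<open>K\<close>.\<close>

lemma ex_compact_open_bisection:
  assumes g: "g \<in> arr G" "src G g \<noteq> rng G g"
    and compact: "compact_space (unit_space G)"
    and clopen_base: "\<forall>U. openin (unit_space G) U \<longrightarrow> (\<forall>x\<in>U.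
      \<exists>K. openin (unit_space G) K \<and> closedin (unit_space G) K \<and> x \<in> K \<and> K \<subseteq> U)"
    and W: "openin (unit_space G) W" "src G g \<in> W" "rng G g \<in> W"
  shows "\<exists>A. compact_open_bisection G A \<and> g \<in> A \<and> src G ` A \<inter> rng G ` A = {} \<and>
    src G ` A \<union> rng G ` A \<subseteq> W"
proof -
  obtain S R where SR: "openin (unit_space G) S" "openin (unit_space G) R"
    "src G g \<in> S" "rng G g \<in> R" "disjnt S R"
    using Hausdorff_unit_space g src_in_units rng_in_units topspace_unit_space
    unfolding Hausdorff_space_def by metis
  obtain U where U: "openin (gtop G) U" "g \<in> U" "bisection G U"
    and hom: "homeomorphic_map (subtopology (gtop G) U) (subtopology (unit_space G) (rng G ` U)) (rng G)"
    using ex_open_bisection[OF g(1)] by blast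
  \<comment> \<open>The nested comprehension allows the open preimage rule to be applied twice, once
    for source and once for range.\<close>
  define N where "N = {h \<in> {h \<in> U. src G h \<in> W \<inter> S}. rng G h \<in> W \<inter> R}"
  have N: "openin (gtop G) N"
    unfolding N_def using U(1) W(1) SR
    by (intro openin_continuous_map_preimage_gen[OF continuous_rng_units]
        openin_continuous_map_preimage_gen[OF continuous_src_units] openin_Int)
  have gN: "g \<in> N" using U(2) W SR by (simp add: N_def)
  have "openin (unit_space G) (rng G ` N)" using N open_map_rng unfolding open_map_def by blast
  then obtain K where K: "openin (unit_space G) K" "closedin (unit_space G) K" "rng G g \<in> K" "K \<subseteq> rng G ` N"
    using clopen_base gN by blast
  let ?A = "{h \<in> N. rng G h \<in> K}"
  have NU: "N \<subseteq> U" by (auto simp: N_def)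
  have "openin (gtop G) ?A"
    using openin_continuous_map_preimage_gen[OF continuous_rng_units N K(1)] .
  moreover have bis: "bisection G ?A"
    using U(3) NU unfolding bisection_def by (blast intro: inj_on_subset)
  moreover have "compactin (gtop G) ?A"
  proof -
    have "rng G ` ?A = K" using K(4) by blast
    moreover have "compactin (unit_space G) K" using closedin_compact_space[OF compact K(2)] .
    moreover have "K \<subseteq> rng G ` U" using K(4) NU by blast
    ultimately have "compactin (subtopology (unit_space G) (rng G ` U)) (rng G ` ?A)"
      by (simp add: compactin_subtopology)
    moreover have "?A \<subseteq> topspace (subtopology (gtop G) U)"
      using NU U(1) openin_subset by auto
    ultimately have "compactin (subtopology (gtop G) U) ?A"
      using homeomorphic_map_compactness[OF hom] by blast
    then show ?thesis by (simp add: compactin_subtopology)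
  qed
  moreover have "src G ` ?A \<inter> rng G ` ?A = {}"
    using SR(5) by (auto simp: N_def disjnt_iff)
  moreover have "src G ` ?A \<union> rng G ` ?A \<subseteq> W" by (auto simp: N_def)
  ultimately show ?thesis using gN K(3) unfolding compact_open_bisection_def by blast
qed


section \<open>Transpositions and their commutators in the full group\<close>

lemma inj_on_Un_disjoint_images:
  assumes "inj_on f A" "inj_on f B" "f ` A \<inter> f ` B = {}"
  shows "inj_on f (A \<union> B)"
  using assms unfolding inj_on_Un by blast

text \<open>The arrows of \<open>A\<close>, their inverses and the units away from both ends of
  \<open>A\<close> together form a full bisection \<open>T\<close>. It swaps the two ends of each
  arrow of \<open>A\<close>. Openness of the unit set makes the third piece open among the
  arrows.\<close>

lemma ex_transposition_in_full_group:
  assumes A: "compact_open_bisection G A" and disj: "src G ` A \<inter> rng G ` A = {}"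
    and open_units: "openin (gtop G) (units G)" and compact: "compact_space (unit_space G)"
  shows "\<exists>\<tau>\<in>full_group G. (\<forall>a\<in>A. \<tau> (src G a) = rng G a \<and> \<tau> (rng G a) = src G a) \<and>
    (\<forall>x\<in>units G - (src G ` A \<union> rng G ` A). \<tau> x = x)"
proof -
  have arr: "A \<subseteq> arr G" and inj: "inj_on (rng G) A" "inj_on (src G) A"
    and cA: "compactin (gtop G) A" and oA: "openin (gtop G) A"
    using A by (auto simp: compact_open_bisection_def bisection_def)
  define M where "M = src G ` A \<union> rng G ` A"
  define T where "T = A \<union> ginv G ` A \<union> (units G - M)"
  have M: "M \<subseteq> units G" using arr src_in_units rng_in_units by (auto simp: M_def)
  \<comment> \<open>\<open>M\<close> is clopen: source and range are open maps, and continuous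
    images of the compact set \<open>A\<close> are closed in a Hausdorff space.\<close>
  have "openin (unit_space G) M"
    using oA open_map_src open_map_rng by (auto simp: M_def open_map_def)
  moreover have "compactin (unit_space G) M"
    using cA continuous_src_units continuous_rng_units
    by (auto simp: M_def intro: compactin_Un image_compactin)
  then have "closedin (unit_space G) M"
    using compactin_imp_closedin Hausdorff_unit_space by blast
  ultimately have rest: "openin (unit_space G) (units G - M)" "closedin (unit_space G) (units G - M)"
    by (metis openin_diff openin_topspace topspace_unit_space,
        metis closedin_diff closedin_topspace topspace_unit_space)
  have "compactin (unit_space G) (units G - M)"
    using closedin_compact_space compact rest(2) by blast
  then have "compactin (gtop G) (units G - M)"
    by (simp add: unit_space_def compactin_subtopology)
  then have cT: "compactin (gtop G) T"
    using cA image_compactin[OF cA continuous_inv] unfolding T_def by (intro compactin_Un)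
  have "openin (gtop G) (units G - M)"
    using rest(1) open_units unfolding unit_space_def by (rule openin_trans_full)
  then have oT: "openin (gtop G) T"
    using oA openin_image_inv[OF oA] unfolding T_def by (intro openin_Un)
  have unit: "src G x = x" "rng G x = x" if "x \<in> units G" for x
    using that src_unit rng_unit by auto
  have inv: "src G (ginv G a) = rng G a" "rng G (ginv G a) = src G a" if "a \<in> A" for a
    using that arr inv_src_rng by auto
  have img: "src G ` ginv G ` A = rng G ` A" "rng G ` ginv G ` A = src G ` A"
    "src G ` (units G - M) = units G - M" "rng G ` (units G - M) = units G - M"
    using arr unit by (simp_all add: rng_image_inv src_image_inv)
  have "inj_on (src G) (ginv G ` A)" "inj_on (rng G) (ginv G ` A)"
    using inj by (auto simp: inj_on_def inv)
  moreover have "inj_on (src G) (units G - M)" "inj_on (rng G) (units G - M)"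
    using unit by (simp_all add: inj_on_def)
  \<comment> \<open>The three pieces of \<open>T\<close> have pairwise disjoint sources and pairwise
    disjoint ranges, so injectivity on the pieces gives injectivity on \<open>T\<close>.\<close>
  moreover have "(src G ` A \<union> rng G ` A) \<inter> (units G - M) = {}"
      "(rng G ` A \<union> src G ` A) \<inter> (units G - M) = {}" "rng G ` A \<inter> src G ` A = {}"
    using disj by (auto simp: M_def)
  ultimately have "inj_on (src G) T" "inj_on (rng G) T"
    unfolding T_def by (intro inj_on_Un_disjoint_images inj; simp only: image_Un img disj)+
  moreover have "src G ` T = units G" "rng G ` T = units G"
    unfolding T_def image_Un img using M by (auto simp: M_def)
  moreover have "T \<subseteq> arr G" using oT by (rule openin_subset)
  ultimately have "bisection_homeo G T \<in> full_group G"
    using cT oT by (simp add: full_group_def full_bisection_def compact_open_bisection_def bisection_def)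
  have val: "bisection_homeo G T (src G t) = rng G t" if "t \<in> T" for t
    using bisection_homeo_src[OF \<open>inj_on (src G) T\<close> that] that \<open>T \<subseteq> arr G\<close> src_in_units by blast
  have "bisection_homeo G T (src G a) = rng G a \<and> bisection_homeo G T (rng G a) = src G a"
    if "a \<in> A" for a
    using val[of a] val[of "ginv G a"] that inv[OF that] by (simp add: T_def)
  moreover have "bisection_homeo G T x = x" if "x \<in> units G - (src G ` A \<union> rng G ` A)" for x
    using val[of x] that unit[of x] by (simp add: T_def M_def)
  ultimately show ?thesis using \<open>bisection_homeo G T \<in> full_group G\<close> by blast
qed

lemma commutator_full_group_moves_fixing:
  assumes cantor: "cantor_space (unit_space G)" and open_units: "openin (gtop G) (units G)"
    and minimal: "minimal_groupoid G"
    and x: "x \<in> units G" and y: "y \<in> units G" and xy: "x \<noteq> y"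
    and W: "openin (unit_space G) W" "W \<noteq> {}"
  shows "\<exists>\<gamma>\<in>commutator_full_group G. \<gamma> y = y \<and> \<gamma> x \<in> W"
proof -
  interpret B: group "BijGroup (units G)" by (rule group_BijGroup)
  note compact = cantor_space_compact[OF cantor]
  have t1: "t1_space (unit_space G)" using Hausdorff_unit_space by (rule Hausdorff_imp_t1_space)
  \<comment> \<open>A dense orbit meets every nonempty open set, and removing finitely many points
    keeps \<open>V\<close> open and nonempty.\<close>
  have orbit_meets: "\<exists>g\<in>arr G. src G g = x \<and> rng G g \<in> V - F"
    if V: "openin (unit_space G) V" "V \<noteq> {}" "finite F" for V F
  proof -
    have "openin (unit_space G) (V - F)" "V - F \<noteq> {}"
      using cantor_space_open_minus_finite[OF cantor t1 V(3,1,2)] by auto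
    moreover have "unit_space G closure_of (rng G ` {g \<in> arr G. src G g = x}) = topspace (unit_space G)"
      using minimal x by (simp add: minimal_groupoid_def topspace_unit_space)
    ultimately have "rng G ` {g \<in> arr G. src G g = x} \<inter> (V - F) \<noteq> {}"
      unfolding dense_intersects_open by blast
    then show ?thesis by blast
  qed
  obtain g where g: "g \<in> arr G" "src G g = x" "rng G g \<in> W - {x, y}"
    using orbit_meets[OF W, of "{x, y}"] by blast
  obtain h where h: "h \<in> arr G" "src G h = x" "rng G h \<in> W - {x, y, rng G g}"
    using orbit_meets[OF W, of "{x, y, rng G g}"] by blast
  define u where "u = rng G g"
  define v where "v = rng G h"
  have uv: "u \<in> units G" "v \<in> units G" "u \<in> W" "u \<noteq> x" "u \<noteq> y" "v \<noteq> x" "v \<noteq> y" "v \<noteq> u"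
    using g(1,3) h(1,3) rng_in_units by (auto simp: u_def v_def)
  have ne: "units G \<noteq> {}" using x by blast
  have "openin (unit_space G) (units G - F) \<and> units G - F \<noteq> {}" if "finite F" for F
    using cantor_space_open_minus_finite[OF cantor t1 that openin_topspace] ne topspace_unit_space
    by simp
  then have open_F: "openin (unit_space G) (units G - F)" if "finite F" for F
    using that by simp
  have clopen: "\<forall>V. openin (unit_space G) V \<longrightarrow> (\<forall>z\<in>V.
      \<exists>K. openin (unit_space G) K \<and> closedin (unit_space G) K \<and> z \<in> K \<and> K \<subseteq> V)"
    using cantor_space_clopen_base[OF cantor] by meson
  \<comment> \<open>The bisection around \<open>k\<close> is chosen inside the complement of the
    finite set \<open>F\<close>, so the transposition exchanges the ends of \<open>k\<close> and
    fixes \<open>F\<close> pointwise.\<close>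
  have tau: "\<exists>\<tau>\<in>full_group G. \<tau> (src G k) = rng G k \<and> \<tau> (rng G k) = src G k \<and> (\<forall>z\<in>F. \<tau> z = z)"
    if k: "k \<in> arr G" "src G k \<noteq> rng G k" "src G k \<notin> F" "rng G k \<notin> F"
    and F: "finite F" "F \<subseteq> units G" for k F
  proof -
    have "src G k \<in> units G - F" "rng G k \<in> units G - F"
      using k src_in_units rng_in_units by simp_all
    note ex_compact_open_bisection[OF k(1,2) compact clopen open_F[OF F(1)] this]
    then obtain A where A: "compact_open_bisection G A" "k \<in> A" "src G ` A \<inter> rng G ` A = {}"
      "src G ` A \<union> rng G ` A \<subseteq> units G - F" by (elim exE conjE)
    from ex_transposition_in_full_group[OF A(1,3) open_units compact]
    obtain \<tau> where \<tau>: "\<tau> \<in> full_group G"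
      "\<forall>a\<in>A. \<tau> (src G a) = rng G a \<and> \<tau> (rng G a) = src G a"
      "\<forall>x\<in>units G - (src G ` A \<union> rng G ` A). \<tau> x = x"
      by (elim bexE conjE)
    have "F \<subseteq> units G - (src G ` A \<union> rng G ` A)" using A(4) F(2) by blast
    then show ?thesis using \<tau> A(2) by (intro bexI[of _ \<tau>]) auto
  qed
  obtain \<sigma> where \<sigma>: "\<sigma> \<in> full_group G" "\<sigma> x = u" "\<sigma> v = v" "\<sigma> y = y"
  proof -
    have "src G g \<noteq> rng G g" "src G g \<notin> {v, y}" "rng G g \<notin> {v, y}" "{v, y} \<subseteq> units G"
      using g(2) uv xy y by (auto simp: u_def)
    from tau[OF g(1) this(1-3) _ this(4)] show ?thesis
      using that g(2) by (auto simp: u_def)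
  qed
  obtain \<rho> where \<rho>: "\<rho> \<in> full_group G" "\<rho> x = v" "\<rho> v = x" "\<rho> y = y"
  proof -
    have "src G h \<noteq> rng G h" "src G h \<notin> {y}" "rng G h \<notin> {y}" "{y} \<subseteq> units G"
      using h(2) uv xy y by (auto simp: v_def)
    from tau[OF h(1) this(1-3) _ this(4)] show ?thesis
      using that h(2) by (auto simp: v_def)
  qed
  have carr: "\<sigma> \<in> carrier (BijGroup (units G))" "\<rho> \<in> carrier (BijGroup (units G))"
    using full_group_subset_homeo_group \<sigma>(1) \<rho>(1) by (auto simp: homeo_group_def topspace_unit_space)
  let ?i = "\<lambda>\<theta>. inv\<^bsub>BijGroup (units G)\<^esub> \<theta>"
  \<comment> \<open>Read from right to left, the four factors carry \<open>x\<close> to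
    \<open>v\<close>, leave \<open>v\<close> in place, and then carry it to \<open>x\<close> and on
    to \<open>u\<close>. Every factor fixes \<open>y\<close>.\<close>
  define \<gamma> where "\<gamma> = \<sigma> \<otimes>\<^bsub>BijGroup (units G)\<^esub> \<rho> \<otimes>\<^bsub>BijGroup (units G)\<^esub> ?i \<sigma> \<otimes>\<^bsub>BijGroup (units G)\<^esub> ?i \<rho>"
  have "\<gamma> \<in> commutator_full_group G"
    unfolding commutator_full_group_def derived_def \<gamma>_def
    by (rule generate.incl, rule UN_I[OF \<sigma>(1)], rule UN_I[OF \<rho>(1)], rule singletonI)
  moreover have inv: "?i \<sigma> v = v" "?i \<sigma> y = y" "?i \<rho> x = v" "?i \<rho> y = y"
    using inv_BijGroup_apply[OF carr(1) uv(2)] inv_BijGroup_apply[OF carr(1) y]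
      inv_BijGroup_apply[OF carr(2) uv(2)] inv_BijGroup_apply[OF carr(2) y] \<sigma>(3,4) \<rho>(3,4)
    by simp_all
  then have "\<gamma> x = u" "\<gamma> y = y"
    using \<sigma>(2-4) \<rho>(2-4) x y uv(1,2) by (simp_all add: \<gamma>_def mult_BijGroup_apply carr)
  ultimately show ?thesis using uv(3) by (intro bexI[of _ \<gamma>]) simp_all
qed

end


section \<open>Semidirect products\<close>

locale groupoid_automorphism_action = etale_groupoid G
  for G :: "('a, 'm) top_groupoid_scheme" (structure) +
  fixes A :: "('b, 'c) monoid_scheme" and lam :: "'b \<Rightarrow> 'a \<Rightarrow> 'a"
  assumes act: "acts_by_automorphisms A G lam"
begin

sublocale lam: group_action A "arr G" lam
  using act by (simp add: acts_by_automorphisms_def)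

sublocale A: group A
  using lam.group_hom by (simp add: group_hom_def)

lemma homeomorphic_map_lam: "a \<in> carrier A \<Longrightarrow> homeomorphic_map (gtop G) (gtop G) (lam a)"
  using act by (auto simp: acts_by_automorphisms_def groupoid_automorphism_def)

lemma lam_one: "g \<in> arr G \<Longrightarrow> lam \<one>\<^bsub>A\<^esub> g = g"
  using lam.id_eq_one by (metis restrict_apply)

lemma lam_inv:
  assumes "a \<in> carrier A" "g \<in> arr G"
  shows "lam a (lam (inv\<^bsub>A\<^esub> a) g) = g"
  using lam.composition_rule[OF assms(2,1) A.inv_closed[OF assms(1)]] assms by (simp add: lam_one)

text \<open>Units are idempotent, and idempotence survives an automorphism.\<close>

lemma lam_units:
  assumes "a \<in> carrier A" "x \<in> units G"
  shows "lam a x \<in> units G"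
proof -
  have "(x, x) \<in> composable_pairs G" "gmul G x x = x"
    using assms(2) units_subset_arr src_unit[of x] rng_unit[of x] mul_src[of x]
    by (auto simp: composable_pairs_def)
  moreover have "\<forall>(g, h)\<in>composable_pairs G. (lam a g, lam a h) \<in> composable_pairs G \<and>
      lam a (gmul G g h) = gmul G (lam a g) (lam a h)"
    using act assms(1) by (simp add: acts_by_automorphisms_def groupoid_automorphism_def)
  ultimately show ?thesis by (intro idempotent_in_units) fastforce+
qed

lemma restrict_lam_in_homeo_group:
  assumes a: "a \<in> carrier A"
  shows "restrict (lam a) (units G) \<in> homeo_group (unit_space G)"
proof -
  have "lam a ` units G = units G"
  proof
    \<comment> \<open>The inverse group element preserves units as well, which supplies the
      preimages.\<close>
    show "units G \<subseteq> lam a ` units G"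
      using lam_units[OF A.inv_closed[OF a]] lam_inv[OF a] units_subset_arr by (metis image_eqI subset_iff)
  qed (use lam_units a in blast)
  then have "homeomorphic_map (unit_space G) (unit_space G) (lam a)"
    unfolding unit_space_def using units_subset_arr homeomorphic_map_lam[OF a]
    by (intro homeomorphic_map_subtopologies) (simp_all add: Int_absorb1)
  from restrict_in_homeo_group[OF this] show ?thesis by (simp add: topspace_unit_space)
qed

abbreviation "H \<equiv> semidirect G A lam"

lemma gtop_semidirect: "gtop H = prod_topology (gtop G) (discrete_topology (carrier A))"
  by (simp add: semidirect_def)

lemma arr_semidirect: "arr H = arr G \<times> carrier A"
  by (simp add: gtop_semidirect)

lemmas rng_semidirect = rng_src_semidirect(1)[OF groupoid_axioms act]
  and src_semidirect = rng_src_semidirect(2)[OF groupoid_axioms act]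

lemma units_semidirect: "units H = units G \<times> {\<one>\<^bsub>A\<^esub>}"
proof
  show "units H \<subseteq> units G \<times> {\<one>\<^bsub>A\<^esub>}"
    using lam_units src_in_units by (auto simp: units_def[of H] arr_semidirect src_semidirect)
  have "(x, \<one>\<^bsub>A\<^esub>) = src H (x, \<one>\<^bsub>A\<^esub>)" "(x, \<one>\<^bsub>A\<^esub>) \<in> arr H" if "x \<in> units G" for x
    using that units_subset_arr by (auto simp: src_semidirect arr_semidirect src_unit lam_one subset_iff)
  then show "units G \<times> {\<one>\<^bsub>A\<^esub>} \<subseteq> units H" unfolding units_def[of H] by blast
qed

lemma unit_space_semidirect:
  "unit_space H = prod_topology (unit_space G) (discrete_topology {\<one>\<^bsub>A\<^esub>})"
  by (simp add: unit_space_def gtop_semidirect units_semidirect subtopology_Times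
      subtopology_discrete_topology)

lemma topspace_unit_space_semidirect: "topspace (unit_space H) = units G \<times> {\<one>\<^bsub>A\<^esub>}"
  by (simp add: unit_space_semidirect topspace_unit_space)

lemma continuous_rng_semidirect: "continuous_map (gtop H) (gtop H) (rng H)"
proof -
  have "continuous_map (gtop H) (gtop H) (\<lambda>p. (rng G (fst p), \<one>\<^bsub>A\<^esub>))"
    unfolding gtop_semidirect
    by (intro continuous_map_pairedI continuous_map_compose[OF continuous_map_fst continuous_rng, unfolded o_def])
      simp
  then show ?thesis
    by (rule continuous_map_eq) (auto simp: arr_semidirect rng_semidirect)
qed

lemma continuous_src_semidirect: "continuous_map (gtop H) (gtop H) (src H)"
proof -
  have "continuous_map (gtop H) (gtop G) (\<lambda>p. lam (inv\<^bsub>A\<^esub> (snd p)) (src G (fst p)))"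
    unfolding continuous_map_def
  proof (intro conjI allI impI)
    show "(\<lambda>p. lam (inv\<^bsub>A\<^esub> (snd p)) (src G (fst p))) \<in> arr H \<rightarrow> arr G"
      using lam_units src_in_units units_subset_arr by (force simp: arr_semidirect)
    fix W assume W: "openin (gtop G) W"
    \<comment> \<open>The second coordinate is discrete, so the preimage of \<open>W\<close> splits
      into slices \<open>V a \<times> {a}\<close>, and on each slice only the single homeomorphism
      \<open>lam (inv a)\<close> is involved.\<close>
    define V where "V a = {g \<in> arr G. lam (inv\<^bsub>A\<^esub> a) (src G g) \<in> W}" for a
    have "openin (gtop G) (V a)" if "a \<in> carrier A" for a
    proof -
      have "continuous_map (gtop G) (gtop G) (lam (inv\<^bsub>A\<^esub> a) \<circ> src G)"
        using continuous_src homeomorphic_imp_continuous_map[OF homeomorphic_map_lam] that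
        by (intro continuous_map_compose) auto
      then show ?thesis using openin_continuous_map_preimage W unfolding V_def by fastforce
    qed
    then have "openin (gtop H) (\<Union>a\<in>carrier A. V a \<times> {a})"
      by (intro openin_Union) (auto simp: gtop_semidirect openin_prod_Times_iff)
    moreover have "{p \<in> arr H. lam (inv\<^bsub>A\<^esub> (snd p)) (src G (fst p)) \<in> W} = (\<Union>a\<in>carrier A. V a \<times> {a})"
      by (auto simp: arr_semidirect V_def)
    ultimately show "openin (gtop H) {p \<in> arr H. lam (inv\<^bsub>A\<^esub> (snd p)) (src G (fst p)) \<in> W}" by simp
  qed
  then have "continuous_map (gtop H) (gtop H) (\<lambda>p. (lam (inv\<^bsub>A\<^esub> (snd p)) (src G (fst p)), \<one>\<^bsub>A\<^esub>))"
    by (simp add: gtop_semidirect continuous_map_pairedI)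
  then show ?thesis
    by (rule continuous_map_eq) (auto simp: arr_semidirect src_semidirect)
qed

lemma full_group_semidirect_subset: "full_group H \<subseteq> homeo_group (unit_space H)"
proof -
  have "Hausdorff_space (gtop H)"
    using Hausdorff by (simp add: gtop_semidirect Hausdorff_space_prod_topology)
  moreover have "units H \<subseteq> arr H"
    using units_subset_arr by (auto simp: units_semidirect arr_semidirect)
  ultimately show ?thesis
    using bisection_homeo_in_homeo_group[OF continuous_src_semidirect continuous_rng_semidirect]
    by (auto simp: full_group_def)
qed

section \<open>Transport of permutations along the identification of \<open>(x, \<one>)\<close> with
  \<open>x\<close>\<close>

abbreviation "transport \<equiv> \<lambda>\<theta>. \<lambda>x\<in>units G. fst (\<theta> (x, \<one>\<^bsub>A\<^esub>))"

lemma transport_in_BijGroup: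
  assumes "\<theta> \<in> carrier (BijGroup (units H))"
  shows "transport \<theta> \<in> carrier (BijGroup (units G))"
proof -
  have "bij_betw \<theta> (units G \<times> {\<one>\<^bsub>A\<^esub>}) (units G \<times> {\<one>\<^bsub>A\<^esub>})"
    using assms by (simp add: BijGroup_def Bij_def units_semidirect)
  moreover have "bij_betw (\<lambda>x. (x, \<one>\<^bsub>A\<^esub>)) (units G) (units G \<times> {\<one>\<^bsub>A\<^esub>})"
    "bij_betw fst (units G \<times> {\<one>\<^bsub>A\<^esub>}) (units G)"
    by (auto simp: bij_betw_def inj_on_def image_def)
  ultimately have "bij_betw (fst \<circ> (\<theta> \<circ> (\<lambda>x. (x, \<one>\<^bsub>A\<^esub>)))) (units G) (units G)"
    by (intro bij_betw_trans)
  then have "bij_betw (transport \<theta>) (units G) (units G)"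
    by (rule bij_betw_cong[THEN iffD1, rotated]) simp
  then show ?thesis by (simp add: BijGroup_def Bij_def)
qed

text \<open>Transport is conjugation by the bijection from \<open>x\<close> to
  \<open>(x, \<one>)\<close>, hence multiplicative.\<close>

lemma group_hom_transport: "group_hom (BijGroup (units H)) (BijGroup (units G)) transport"
proof -
  have "transport (\<theta> \<otimes>\<^bsub>BijGroup (units H)\<^esub> \<eta>) = transport \<theta> \<otimes>\<^bsub>BijGroup (units G)\<^esub> transport \<eta>"
    if \<theta>: "\<theta> \<in> carrier (BijGroup (units H))" and \<eta>: "\<eta> \<in> carrier (BijGroup (units H))" for \<theta> \<eta>
  proof
    fix x
    show "transport (\<theta> \<otimes>\<^bsub>BijGroup (units H)\<^esub> \<eta>) x =
        (transport \<theta> \<otimes>\<^bsub>BijGroup (units G)\<^esub> transport \<eta>) x"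
    proof (cases "x \<in> units G")
      case True
      then have x: "(x, \<one>\<^bsub>A\<^esub>) \<in> units H" by (simp add: units_semidirect)
      have "\<eta> (x, \<one>\<^bsub>A\<^esub>) \<in> units H"
        using \<eta> x by (auto simp: BijGroup_def dest: Bij_imp_funcset)
      then obtain y where y: "\<eta> (x, \<one>\<^bsub>A\<^esub>) = (y, \<one>\<^bsub>A\<^esub>)" "y \<in> units G"
        by (auto simp: units_semidirect)
      then show ?thesis
        using True by (simp add: mult_BijGroup_apply[OF \<theta> \<eta> x] transport_in_BijGroup \<theta> \<eta>
            mult_BijGroup_apply[OF transport_in_BijGroup[OF \<theta>] transport_in_BijGroup[OF \<eta>] True])
    next
      \<comment> \<open>Outside the units both sides take the default value
        \<open>undefined\<close>, by extensionality.\<close>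
      case False
      have "transport \<theta> \<otimes>\<^bsub>BijGroup (units G)\<^esub> transport \<eta> \<in> carrier (BijGroup (units G))"
        using transport_in_BijGroup[OF \<theta>] transport_in_BijGroup[OF \<eta>]
        by (rule monoid.m_closed[OF group.is_monoid[OF group_BijGroup]])
      then have "(transport \<theta> \<otimes>\<^bsub>BijGroup (units G)\<^esub> transport \<eta>) x = undefined"
        using False by (simp only: BijGroup_def partial_object.simps Bij_def extensional_def) blast
      then show ?thesis using False by (simp only: restrict_apply if_False)
    qed
  qed
  then show ?thesis
    using transport_in_BijGroup
    by (intro group_hom.intro group_hom_axioms.intro group_BijGroup homI) auto
qed

lemma transport_in_homeo_group:
  assumes "\<theta> \<in> homeo_group (unit_space H)"
  shows "transport \<theta> \<in> homeo_group (unit_space G)"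
proof -
  have "homeomorphic_maps (unit_space G) (unit_space H) (\<lambda>x. (x, \<one>\<^bsub>A\<^esub>)) fst"
    by (auto simp: homeomorphic_maps_def unit_space_semidirect continuous_map_pairedI continuous_map_fst)
  then have "homeomorphic_map (unit_space G) (unit_space H) (\<lambda>x. (x, \<one>\<^bsub>A\<^esub>))"
    "homeomorphic_map (unit_space H) (unit_space G) fst"
    by (simp_all add: homeomorphic_maps_map)
  moreover have "homeomorphic_map (unit_space H) (unit_space H) \<theta>"
    using assms by (simp add: homeo_group_def)
  ultimately have "homeomorphic_map (unit_space G) (unit_space G) (fst \<circ> (\<theta> \<circ> (\<lambda>x. (x, \<one>\<^bsub>A\<^esub>))))"
    by (intro homeomorphic_map_compose)
  from restrict_in_homeo_group[OF this] show ?thesis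
    by (simp add: topspace_unit_space o_def)
qed

text \<open>The identity of \<open>A\<close> acts trivially, so arrows \<open>(g, \<one>)\<close>
  have the source and range of \<open>g\<close>. This places the full group of \<open>G\<close>
  inside the transported full group of \<open>H\<close>.\<close>

lemma full_bisection_semidirect:
  assumes "full_bisection G U"
  shows "full_bisection H (U \<times> {\<one>\<^bsub>A\<^esub>})"
    and "transport (bisection_homeo H (U \<times> {\<one>\<^bsub>A\<^esub>})) = bisection_homeo G U"
proof -
  let ?U = "U \<times> {\<one>\<^bsub>A\<^esub>}"
  have U: "U \<subseteq> arr G" "inj_on (rng G) U" "inj_on (src G) U" "compactin (gtop G) U"
      "openin (gtop G) U" "rng G ` U = units G" "src G ` U = units G"
    using assms by (auto simp: full_bisection_def compact_open_bisection_def bisection_def)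
  have rs: "rng H (g, \<one>\<^bsub>A\<^esub>) = (rng G g, \<one>\<^bsub>A\<^esub>)" "src H (g, \<one>\<^bsub>A\<^esub>) = (src G g, \<one>\<^bsub>A\<^esub>)" if "g \<in> U" for g
    using that U(1) src_closed by (auto simp: rng_semidirect src_semidirect lam_one subset_iff)
  have inj: "inj_on (rng H) ?U" "inj_on (src H) ?U"
    using U(2,3) by (auto simp: inj_on_def rs)
  moreover have "rng H ` ?U = units H"
    unfolding units_semidirect U(6)[symmetric] by (force simp: rs)
  moreover have "src H ` ?U = units H"
    unfolding units_semidirect U(7)[symmetric] by (force simp: rs)
  moreover have "openin (gtop H) ?U" "compactin (gtop H) ?U"
    using U(4,5) by (auto simp: gtop_semidirect openin_prod_Times_iff compactin_Times)
  moreover have "?U \<subseteq> arr H" using U(1) by (auto simp: arr_semidirect)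
  ultimately show "full_bisection H ?U"
    by (simp add: full_bisection_def compact_open_bisection_def bisection_def)
  show "transport (bisection_homeo H ?U) = bisection_homeo G U"
  proof
    fix x
    show "transport (bisection_homeo H ?U) x = bisection_homeo G U x"
    proof (cases "x \<in> units G")
      case True
      then obtain g where g: "g \<in> U" "x = src G g" using U(7) by blast
      then show ?thesis
        using True bisection_homeo_src[OF inj(2), of "(g, \<one>\<^bsub>A\<^esub>)"] bisection_homeo_src[OF U(3) g(1)]
        by (simp add: rs units_semidirect)
    qed (simp add: bisection_homeo_def)
  qed
qed

text \<open>Homomorphisms carry derived subgroups to derived subgroups. In this form the group can
  be compared with \<open>commutator_full_group G\<close> by monotonicity of \<open>derived\<close>
  inside a single ambient group.\<close>

lemma semidirect_commutator_full_group_eq: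
  "semidirect_commutator_full_group G A lam = derived (BijGroup (units G)) (transport ` full_group H)"
proof -
  have "full_group H \<subseteq> carrier (BijGroup (units H))"
    using full_group_semidirect_subset
    by (auto simp: homeo_group_def topspace_unit_space_semidirect units_semidirect)
  then show ?thesis
    unfolding semidirect_commutator_full_group_def commutator_full_group_def
    by (rule group_hom.derived_img[OF group_hom_transport, symmetric])
qed

lemma transport_full_group:
  "full_group G \<subseteq> transport ` full_group H" "transport ` full_group H \<subseteq> homeo_group (unit_space G)"
proof -
  show "full_group G \<subseteq> transport ` full_group H"
    using full_bisection_semidirect unfolding full_group_def by (force simp del: restrict_apply)
  show "transport ` full_group H \<subseteq> homeo_group (unit_space G)"
    using transport_in_homeo_group full_group_semidirect_subset by blast
qed

end

section \<open>Normalizers relative to a subgroup\<close>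

lemma (in group) normalizer_in_eq:
  assumes "\<Gamma> \<subseteq> carrier G" "S \<subseteq> carrier G"
  shows "normalizer_in G \<Gamma> S = \<Gamma> \<inter> normalizer G S"
  using assms by (auto simp: normalizer_in_def normalizer_def stabilizer_def)

lemma (in group) subgroup_normalizer_in:
  assumes "subgroup \<Gamma> G" "S \<subseteq> carrier G"
  shows "subgroup (normalizer_in G \<Gamma> S) G"
  using assms normalizer_in_eq normalizer_imp_subgroup subgroups_Inter_pair subgroup.subset by metis

text \<open>A subgroup is normal in its own normalizer, in particular contained in it.\<close>

lemma (in group) subset_normalizer_in:
  assumes "subgroup \<Gamma> G" "subgroup S G" "S \<subseteq> \<Gamma>"
  shows "S \<subseteq> normalizer_in G \<Gamma> S"
proof -
  have "subgroup S (G\<lparr>carrier := normalizer G S\<rparr>)"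
    using subgroup_in_normalizer[OF assms(2)] by (rule normal_imp_subgroup)
  then have "S \<subseteq> normalizer G S" using subgroup.subset by force
  then show ?thesis
    using assms normalizer_in_eq[of \<Gamma> S] subgroup.subset by blast
qed

section \<open>The three groups acting on the unit space\<close>

theorem proposition5p5:
  fixes G :: "'a top_groupoid" and p :: nat and lam :: "int \<Rightarrow> 'a \<Rightarrow> 'a"
  assumes "prime p"
    and "ample_groupoid G"
    and "cantor_space (unit_space G)"
    and "acts_by_automorphisms (integer_mod_group p) G lam"
    and "free_on_units (integer_mod_group p) G lam"
    and "H = semidirect G (integer_mod_group p) lam"
    and "effective_groupoid G" and "minimal_groupoid G"
    and "almost_finite G \<or> purely_infinite G"
    and "effective_groupoid H" and "minimal_groupoid H"
    and "almost_finite H \<or> purely_infinite H"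
  shows "acts_topologically_primitively (unit_space G)
           (full_group_extension G (integer_mod_group p) lam)
       \<and> acts_topologically_primitively (unit_space G)
           (normalizer_in (BijGroup (units G))
             (semidirect_commutator_full_group G (integer_mod_group p) lam)
             (commutator_full_group G))
       \<and> acts_topologically_primitively (unit_space G) (commutator_full_group G)"
proof -
  let ?A = "integer_mod_group p" and ?B = "BijGroup (units G)" and ?X = "unit_space G"
  interpret ample_groupoid G by fact
  interpret groupoid_automorphism_action G ?A lam
    using assms(4) by unfold_locales
  interpret B: group ?B by (rule group_BijGroup)
  note homeo = subgroup_homeo_group[of ?X, unfolded topspace_unit_space]
  have carrier: "homeo_group ?X \<subseteq> carrier ?B" using homeo by (rule subgroup.subset)
  \<comment> \<open>Effectiveness exhibits the unit set as an interior.\<close>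
  have open_units: "openin (gtop G) (units G)"
    using assms(7) unfolding effective_groupoid_def by (metis openin_interior_of)
  have nontriv: "topspace ?X \<noteq> {x}" for x
  proof
    assume "topspace ?X = {x}"
    then have "openin ?X {x}" using openin_topspace by metis
    from cantor_space_clopen_base[OF assms(3) this] obtain K where "K \<subseteq> {x}" "x \<in> K" "K \<noteq> {x}"
      by blast
    then show False by blast
  qed
  \<comment> \<open>The elements supplied by the commutator subgroup remain available in any larger
    group, so every group of homeomorphisms above it is covered. It remains to place each of the
    three groups between \<open>commutator_full_group G\<close> and
    \<open>homeo_group\<close>.\<close>
  have primitive: "acts_topologically_primitively ?X \<Gamma>"
    if "subgroup \<Gamma> ?B" "\<Gamma> \<subseteq> homeo_group ?X" "commutator_full_group G \<subseteq> \<Gamma>" for \<Gamma>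
  proof (rule acts_topologically_primitively_if_moves_fixing)
    show "subgroup \<Gamma> (BijGroup (topspace ?X))" using that(1) by (simp add: topspace_unit_space)
    fix x y W
    assume "x \<in> topspace ?X" "y \<in> topspace ?X" "x \<noteq> y" "openin ?X W" "W \<noteq> {}"
    then show "\<exists>\<gamma>\<in>\<Gamma>. \<gamma> y = y \<and> \<gamma> x \<in> W"
      using commutator_full_group_moves_fixing[OF assms(3) open_units assms(8), of x y W] that(3)
      unfolding topspace_unit_space by blast
  qed (use that nontriv in auto)
  have F: "full_group G \<subseteq> carrier ?B"
    using full_group_subset_homeo_group carrier by (rule subset_trans)
  have D: "subgroup (commutator_full_group G) ?B"
    "commutator_full_group G \<subseteq> homeo_group ?X"
    unfolding commutator_full_group_def
    using B.derived_is_subgroup[OF F] B.derived_incl[OF full_group_subset_homeo_group homeo] by auto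
  let ?E = "full_group_extension G ?A lam"
  have gens: "full_group G \<union> (\<lambda>a. restrict (lam a) (units G)) ` carrier ?A \<subseteq> homeo_group ?X"
    using full_group_subset_homeo_group restrict_lam_in_homeo_group by blast
  have E: "subgroup ?E ?B" "?E \<subseteq> homeo_group ?X"
    unfolding full_group_extension_def
    using B.generate_is_subgroup[OF subset_trans[OF gens carrier]] B.generate_subgroup_incl[OF gens homeo]
    by auto
  have "full_group G \<subseteq> ?E"
    unfolding full_group_extension_def by (blast intro: generate.incl)
  then have DE: "commutator_full_group G \<subseteq> ?E"
    unfolding commutator_full_group_def using E(1) by (rule B.derived_incl)
  let ?D = "semidirect_commutator_full_group G ?A lam"
  let ?N = "normalizer_in ?B ?D (commutator_full_group G)"
  have DH: "subgroup ?D ?B" "?D \<subseteq> homeo_group ?X"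
    unfolding semidirect_commutator_full_group_eq
    using B.derived_is_subgroup[OF subset_trans[OF transport_full_group(2) carrier]]
      B.derived_incl[OF transport_full_group(2) homeo] by auto
  \<comment> \<open>The full group of \<open>G\<close> lies in the transported full group of
    \<open>H\<close>, and \<open>derived\<close> is monotone. The relative normalizer
    \<open>?N\<close> therefore contains \<open>commutator_full_group G\<close>.\<close>
  have "commutator_full_group G \<subseteq> ?D"
    unfolding semidirect_commutator_full_group_eq commutator_full_group_def
    using transport_full_group(1) by (rule B.mono_derived)
  then have "commutator_full_group G \<subseteq> ?N"
    using B.subset_normalizer_in DH(1) D(1) by blast
  moreover have "subgroup ?N ?B"
    using DH(1) subgroup.subset[OF D(1)] by (rule B.subgroup_normalizer_in)
  moreover have "?N \<subseteq> homeo_group ?X" using DH(2) by (auto simp: normalizer_in_def)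
  ultimately show ?thesis using primitive D E DE by blast
qed

end
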